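(* Let $0\le a<b$, let $f:[a,b]\to\mathbb{R}$ be a positive function with $f\in L_1[a,b]$, let $\alpha>0$ and $s\in(0,1)$. If $f$ is $s$-convex in the second sense on $[a,b]$, then $$2^{s-1}f\left(\frac{a+b}{2}\right)\le \frac{\Gamma(\alpha+1)}{(b-a)^{\alpha}}\left[\frac{J_{a+}^{\alpha}f(b)+J_{b-}^{\alpha}f(a)}{2}\right]\le \alpha\left[\frac{1}{\alpha+s}+\beta(\alpha,s+1)\right]\frac{f(a)+f(b)}{2}.$$
   Context: A function $f$ is $s$-convex in the second sense on $[a,b]\subset[0,\infty)$, for a fixed $s\in(0,1]$, if $f(\lambda x+(1-\lambda)y)\le \lambda^{s}f(x)+(1-\lambda)^{s}f(y)$ for all $x,y\in[a,b]$ and $\lambda\in[0,1]$. For $f\in L_1[a,b]$ with $a\ge 0$ and $\alpha>0$, the Riemann-Liouville fractional integrals are $$J_{a+}^{\alpha}f(x)=\frac{1}{\Gamma(\alpha)}\int_a^x (x-t)^{\alpha-1}f(t)\,dt\ (x>a),\qquad J_{b-}^{\alpha}f(x)=\frac{1}{\Gamma(\alpha)}\int_x^b (t-x)^{\alpha-1}f(t)\,dt\ (x<b),$$ where $\Gamma$ is the Gamma function. $\beta(x,y)=\int_0^1 t^{x-1}(1-t)^{y-1}\,dt$ is the Euler Beta function. *)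

theory Defs
  imports "HOL-Analysis.Analysis"
begin

text \<open>
  The defining inequality of s-convexity in the second sense on \<open>A\<close>; the conditions that \<open>A\<close> consists of
  nonnegative reals and that \<open>0 < s \<le> 1\<close> are left to the statements using it.  As \<open>0 powr s = 0\<close>, the cases \<open>u = 0\<close> and \<open>u = 1\<close> are trivial,
  as they are with the usual meaning of \<open>0\<close> to a positive power.
\<close>

definition s_convex_on :: "real \<Rightarrow> real set \<Rightarrow> (real \<Rightarrow> real) \<Rightarrow> bool" where
  "s_convex_on s A f \<longleftrightarrow>
     (\<forall>x\<in>A. \<forall>y\<in>A. \<forall>u\<in>{0..1}. f (u * x + (1 - u) * y) \<le> u powr s * f x + (1 - u) powr s * f y)"

text \<open>
  Left-sided (lower limit \<open>a\<close>, for \<open>x > a\<close>) and right-sided (upper limit \<open>b\<close>, for \<open>x < b\<close>)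
  Riemann-Liouville fractional integrals of order \<open>\<alpha> > 0\<close>.  For \<open>t = x\<close> the kernel has the
  value \<open>0 powr (\<alpha> - 1) = 0\<close>, which is irrelevant because a point is a null set.
\<close>

definition RL_left :: "real \<Rightarrow> real \<Rightarrow> (real \<Rightarrow> real) \<Rightarrow> real \<Rightarrow> real" where
  "RL_left a \<alpha> f x =
     1 / Gamma \<alpha> * (LINT t:{a..x}|lebesgue. (x - t) powr (\<alpha> - 1) * f t)"

definition RL_right :: "real \<Rightarrow> real \<Rightarrow> (real \<Rightarrow> real) \<Rightarrow> real \<Rightarrow> real" where
  "RL_right b \<alpha> f x =
     1 / Gamma \<alpha> * (LINT t:{x..b}|lebesgue. (t - x) powr (\<alpha> - 1) * f t)"

text \<open>
  The library defines \<^const>\<open>Beta\<close> as a quotient of Gamma values; for positive real arguments it is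
  Euler's integral.
\<close>

lemma Beta_eq_Euler_integral:
  fixes x y :: real
  assumes "x > 0" "y > 0"
  shows "Beta x y = (LINT t:{0..1}|lebesgue. t powr (x - 1) * (1 - t) powr (y - 1))"
proof -
  have I: "((\<lambda>t. t powr (x - 1) * (1 - t) powr (y - 1)) has_integral Beta x y) {0..1}"
    using has_integral_Beta_real[OF assms] .
  have "(\<lambda>t. t powr (x - 1) * (1 - t) powr (y - 1)) absolutely_integrable_on {0..1}"
    by (rule nonnegative_absolutely_integrable_1) (use I in auto)
  from set_lebesgue_integral_eq_integral(2)[OF this] show ?thesis
    using integral_unique[OF I] by simp
qed

end

theory Submission
  imports Defs
begin

text \<open>
  Both inequalities are integrated forms of pointwise ones.  The substitutions
  \<open>t = u a + (1 - u) b\<close> and \<open>t = u b + (1 - u) a\<close> turn the kernels of the left and of the right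
  fractional integral into the same weight \<open>u powr (\<alpha> - 1)\<close> on the unit interval, so that the
  middle term of the theorem becomes \<open>\<alpha> / 2\<close> times the integral of \<open>u powr (\<alpha> - 1) * h u\<close>, where
  \<open>h u = f (u a + (1 - u) b) + f (u b + (1 - u) a)\<close>
  (lemma \<open>RL_integrals_on_unit_interval\<close>).

  The two arguments of \<open>f\<close> in \<open>h\<close> have the midpoint of \<open>a\<close> and \<open>b\<close> as their own midpoint.
  Hence \<open>s\<close>-convexity with weights \<open>1/2\<close> bounds \<open>h u\<close> from below by a constant, and \<open>s\<close>-convexity
  with weights \<open>u\<close> and \<open>1 - u\<close>, used for both summands, bounds it from above by a multiple of
  \<open>f a + f b\<close> (lemma \<open>s_convex_on_symmetric_bounds\<close>).  Integrating these bounds against the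
  weight gives \<open>1 / \<alpha>\<close> on the left, and \<open>1 / (\<alpha> + s)\<close> and the Beta integral on the right.

  The pointwise bounds can only be integrated if the products of \<open>f\<close> with the kernels are integrable.
  For \<open>\<alpha> < 1\<close> the kernels are unbounded, so integrability of \<open>f\<close> would not suffice;
  but a nonnegative \<open>s\<close>-convex function on a compact interval is bounded by the sum of its values
  at the endpoints.
\<close>

text \<open>
  The substitution \<open>t = u p + (1 - u) q\<close>, with \<open>p\<close> and \<open>q\<close> in either order: the two fractional
  integrals run through the same interval in opposite directions.
\<close>

lemma has_integral_affine_unit:
  fixes g :: "real \<Rightarrow> real"
  assumes "(g has_integral I) {min p q..max p q}" and "p \<noteq> q"
  shows "((\<lambda>u. g (u * p + (1 - u) * q)) has_integral I / \<bar>p - q\<bar>) {0..1}"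
proof -
  have "(g has_integral I) (cbox (min p q) (max p q))"
    using assms(1) by simp
  from has_integral_affinity[OF this, of "p - q" q] assms(2)
  have *: "((\<lambda>u. g ((p - q) * u + q)) has_integral I / \<bar>p - q\<bar>)
          ((\<lambda>x. x / (p - q) - q / (p - q)) ` {min p q..max p q})"
    by simp
  have "p / (p - q) - q / (p - q) = 1"
    using assms(2) by (simp flip: diff_divide_distrib)
  then have "(\<lambda>x. x / (p - q) - q / (p - q)) ` {min p q..max p q} = {0..1}"
    by (auto simp: image_affinity_atLeastAtMost_div_diff min_def max_def)
  with * show ?thesis
    by (simp add: algebra_simps)
qed

text \<open>
  The weights \<open>u powr s\<close> and \<open>(1 - u) powr s\<close> need not add up to at most one when \<open>s < 1\<close>, so the
  maximum of the endpoint values is not a bound; but each weight is at most one.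
\<close>

lemma s_convex_on_le_sum_endpoints:
  assumes "s_convex_on s {a..b} f" and "0 \<le> f a" and "0 \<le> f b" and "0 \<le> s" and "t \<in> {a..b}"
  shows "f t \<le> f a + f b"
proof (cases "a = b")
  case True
  then show ?thesis using assms by auto
next
  case False
  define u where "u = (b - t) / (b - a)"
  have ab: "a < b" using False assms(5) by auto
  have u: "u \<in> {0..1}" using assms(5) ab by (auto simp: u_def field_simps)
  have "u * a + (1 - u) * b = b - u * (b - a)" by (simp add: algebra_simps)
  also have "\<dots> = t" using ab by (simp add: u_def)
  finally have "f t \<le> u powr s * f a + (1 - u) powr s * f b"
    using assms(1) u ab unfolding s_convex_on_def
    by (metis atLeastAtMost_iff less_eq_real_def)
  also have "\<dots> \<le> 1 * f a + 1 * f b"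
    using assms u by (intro add_mono mult_right_mono powr_le1) auto
  finally show ?thesis by simp
qed

lemma s_convex_on_symmetric_bounds:
  fixes f :: "real \<Rightarrow> real"
  assumes "s_convex_on s {a..b} f" and "a \<le> b" and "u \<in> {0..1}"
  defines "h \<equiv> f (u * a + (1 - u) * b) + f (u * b + (1 - u) * a)"
  shows "2 powr s * f ((a + b) / 2) \<le> h"
    and "h \<le> (u powr s + (1 - u) powr s) * (f a + f b)"
proof -
  let ?x = "u * a + (1 - u) * b" and ?y = "u * b + (1 - u) * a"
  have "?x \<in> {a..b}" "?y \<in> {a..b}"
    using convex_bound_le[of a b b u "1 - u"] convex_bound_le[of b b a u "1 - u"]
      convex_bound_le[of "- a" "- a" "- b" u "1 - u"] convex_bound_le[of "- b" "- a" "- a" u "1 - u"]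
      assms by auto
  then have "f (1/2 * ?x + (1 - 1/2) * ?y) \<le> (1/2) powr s * f ?x + (1 - 1/2) powr s * f ?y"
    using assms(1)[unfolded s_convex_on_def, THEN bspec, THEN bspec, THEN bspec, of ?x ?y "1/2"]
    by simp
  also have "1/2 * ?x + (1 - 1/2) * ?y = (a + b) / 2"
    by (simp add: field_simps)
  finally have "f ((a + b) / 2) \<le> h / 2 powr s"
    by (simp add: h_def powr_divide add_divide_distrib)
  then show "2 powr s * f ((a + b) / 2) \<le> h"
    by (simp add: field_simps)
  have "f ?x \<le> u powr s * f a + (1 - u) powr s * f b" "f ?y \<le> u powr s * f b + (1 - u) powr s * f a"
    using assms unfolding s_convex_on_def by auto
  then show "h \<le> (u powr s + (1 - u) powr s) * (f a + f b)"
    by (simp add: h_def algebra_simps)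
qed

lemma has_integral_powr_unit:
  fixes p :: real
  assumes "0 < p"
  shows "((\<lambda>u. u powr (p - 1)) has_integral 1 / p) {0..1}"
  using has_integral_powr_from_0[of "p - 1" 1] assms by simp

text \<open>
  The kernels are integrable because \<open>\<alpha> - 1 > - 1\<close>, and an integrable function times a bounded
  measurable one is integrable.
\<close>

lemma RL_kernel_product_absolutely_integrable:
  fixes f :: "real \<Rightarrow> real"
  assumes "f absolutely_integrable_on {a..b}" and "bounded (f ` {a..b})"
    and "a < b" and "0 < \<alpha>"
  shows "(\<lambda>t. (b - t) powr (\<alpha> - 1) * f t) absolutely_integrable_on {a..b}"
    and "(\<lambda>t. (t - a) powr (\<alpha> - 1) * f t) absolutely_integrable_on {a..b}"
proof -
  have meas: "f \<in> borel_measurable (lebesgue_on {a..b})"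
    using assms(1) by (simp add: absolutely_integrable_measurable)
  have K: "((\<lambda>u. u powr (\<alpha> - 1)) has_integral (b - a) powr \<alpha> / \<alpha>) {0..b - a}"
    using has_integral_powr_from_0[of "\<alpha> - 1" "b - a"] assms by simp
  have "((\<lambda>t. (t - a) powr (\<alpha> - 1)) has_integral (b - a) powr \<alpha> / \<alpha>) {a..b}"
    using has_integral_affinity[of "\<lambda>u. u powr (\<alpha> - 1)" _ 0 "b - a" 1 "- a"] K
    by (simp add: image_affinity_atLeastAtMost)
  then have 1: "(\<lambda>t. (t - a) powr (\<alpha> - 1)) absolutely_integrable_on {a..b}"
    by (intro nonnegative_absolutely_integrable_1) auto
  have "((\<lambda>t. (b - t) powr (\<alpha> - 1)) has_integral (b - a) powr \<alpha> / \<alpha>) {a..b}"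
    using has_integral_affinity[of "\<lambda>u. u powr (\<alpha> - 1)" _ 0 "b - a" "-1" b] K assms(3)
    by (simp add: image_affinity_atLeastAtMost)
  then have 2: "(\<lambda>t. (b - t) powr (\<alpha> - 1)) absolutely_integrable_on {a..b}"
    by (intro nonnegative_absolutely_integrable_1) auto
  note * = absolutely_integrable_bounded_measurable_product_real[OF meas _ assms(2)]
  show "(\<lambda>t. (b - t) powr (\<alpha> - 1) * f t) absolutely_integrable_on {a..b}"
    using *[OF _ 2] by (simp add: mult.commute)
  show "(\<lambda>t. (t - a) powr (\<alpha> - 1) * f t) absolutely_integrable_on {a..b}"
    using *[OF _ 1] by (simp add: mult.commute)
qed

text \<open>
  The kernel contributes a factor \<open>(b - a) powr (\<alpha> - 1)\<close> and the substitution a factor \<open>b - a\<close>;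
  this is why \<open>(b - a) powr \<alpha>\<close> is the natural normalisation of the fractional integrals.
\<close>

lemma RL_integrals_on_unit_interval:
  fixes f :: "real \<Rightarrow> real"
  assumes "f absolutely_integrable_on {a..b}" and "bounded (f ` {a..b})"
    and "a < b" and "0 < \<alpha>"
  shows "((\<lambda>u. u powr (\<alpha> - 1) * f (u * a + (1 - u) * b)) has_integral
            Gamma \<alpha> / (b - a) powr \<alpha> * RL_left a \<alpha> f b) {0..1}"
    and "((\<lambda>u. u powr (\<alpha> - 1) * f (u * b + (1 - u) * a)) has_integral
            Gamma \<alpha> / (b - a) powr \<alpha> * RL_right b \<alpha> f a) {0..1}"
proof -
  note abs_int = RL_kernel_product_absolutely_integrable[OF assms]
  have "Gamma \<alpha> > 0" using assms(4) by simp
  then have L: "((\<lambda>t. (b - t) powr (\<alpha> - 1) * f t) has_integral Gamma \<alpha> * RL_left a \<alpha> f b) {a..b}"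
    and R: "((\<lambda>t. (t - a) powr (\<alpha> - 1) * f t) has_integral Gamma \<alpha> * RL_right b \<alpha> f a) {a..b}"
    using set_lebesgue_integral_eq_integral[OF abs_int(1)]
      set_lebesgue_integral_eq_integral[OF abs_int(2)]
    by (simp_all add: RL_left_def RL_right_def has_integral_iff)
  have d: "(b - a) powr \<alpha> = (b - a) powr (\<alpha> - 1) * (b - a)"
    using assms(3) by (simp add: powr_diff)
  have eq: "b - (u * a + (1 - u) * b) = u * (b - a)" "(u * b + (1 - u) * a) - a = u * (b - a)" for u
    by (simp_all add: algebra_simps)
  have
    "((\<lambda>u. (b - (u * a + (1 - u) * b)) powr (\<alpha> - 1) * f (u * a + (1 - u) * b)) has_integral
      Gamma \<alpha> * RL_left a \<alpha> f b / (b - a)) {0..1}"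
    using has_integral_affine_unit[of _ _ a b] L assms(3) by (simp add: min_def max_def)
  from has_integral_mult_right[OF this, of "1 / (b - a) powr (\<alpha> - 1)"]
  have "((\<lambda>u. 1 / (b - a) powr (\<alpha> - 1) *
       ((u * (b - a)) powr (\<alpha> - 1) * f (u * a + (1 - u) * b))) has_integral
      Gamma \<alpha> / (b - a) powr \<alpha> * RL_left a \<alpha> f b) {0..1}"
    unfolding eq d by (simp add: mult.commute)
  then show "((\<lambda>u. u powr (\<alpha> - 1) * f (u * a + (1 - u) * b)) has_integral
            Gamma \<alpha> / (b - a) powr \<alpha> * RL_left a \<alpha> f b) {0..1}"
    by (rule has_integral_eq[rotated]) (use assms(3) in \<open>auto simp: powr_mult\<close>)
  have
    "((\<lambda>u. ((u * b + (1 - u) * a) - a) powr (\<alpha> - 1) * f (u * b + (1 - u) * a)) has_integral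
      Gamma \<alpha> * RL_right b \<alpha> f a / (b - a)) {0..1}"
    using has_integral_affine_unit[of _ _ b a] R assms(3) by (simp add: min_def max_def)
  from has_integral_mult_right[OF this, of "1 / (b - a) powr (\<alpha> - 1)"]
  have "((\<lambda>u. 1 / (b - a) powr (\<alpha> - 1) *
       ((u * (b - a)) powr (\<alpha> - 1) * f (u * b + (1 - u) * a))) has_integral
      Gamma \<alpha> / (b - a) powr \<alpha> * RL_right b \<alpha> f a) {0..1}"
    unfolding eq d by (simp add: mult.commute)
  then show "((\<lambda>u. u powr (\<alpha> - 1) * f (u * b + (1 - u) * a)) has_integral
            Gamma \<alpha> / (b - a) powr \<alpha> * RL_right b \<alpha> f a) {0..1}"
    by (rule has_integral_eq[rotated]) (use assms(3) in \<open>auto simp: powr_mult\<close>)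
qed

theorem theorem3:
  fixes a b \<alpha> s :: real and f :: "real \<Rightarrow> real"
  assumes "0 \<le> a" and "a < b"
    and "\<And>x. x \<in> {a..b} \<Longrightarrow> 0 < f x"
    and "f absolutely_integrable_on {a..b}"
    and "0 < \<alpha>"
    and "0 < s" and "s < 1"
    and "s_convex_on s {a..b} f"
  shows "2 powr (s - 1) * f ((a + b) / 2)
           \<le> Gamma (\<alpha> + 1) / (b - a) powr \<alpha> * ((RL_left a \<alpha> f b + RL_right b \<alpha> f a) / 2)
       \<and> Gamma (\<alpha> + 1) / (b - a) powr \<alpha> * ((RL_left a \<alpha> f b + RL_right b \<alpha> f a) / 2)
           \<le> \<alpha> * (1 / (\<alpha> + s) + Beta \<alpha> (s + 1)) * ((f a + f b) / 2)"
proof -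
  define h where "h u = f (u * a + (1 - u) * b) + f (u * b + (1 - u) * a)" for u
  define J where "J = Gamma \<alpha> / (b - a) powr \<alpha> * (RL_left a \<alpha> f b + RL_right b \<alpha> f a)"
  have pos: "0 < f a" "0 < f b" using assms(2,3) by auto
  have "bounded (f ` {a..b})"
  proof (rule boundedI)
    fix y assume "y \<in> f ` {a..b}"
    then obtain t where t: "t \<in> {a..b}" "y = f t" by auto
    have "f t \<le> f a + f b"
      by (rule s_convex_on_le_sum_endpoints[OF assms(8)]) (use pos assms(6) t in auto)
    then show "norm y \<le> f a + f b" using assms(3)[OF t(1)] t(2) by simp
  qed
  note RL = RL_integrals_on_unit_interval[OF assms(4) this assms(2,5)]
  have J: "((\<lambda>u. u powr (\<alpha> - 1) * h u) has_integral J) {0..1}"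
    using has_integral_add[OF RL] by (simp add: h_def J_def algebra_simps)
  have bounds: "2 powr s * f ((a + b) / 2) \<le> h u"
    "h u \<le> (u powr s + (1 - u) powr s) * (f a + f b)" if "u \<in> {0..1}" for u
    using s_convex_on_symmetric_bounds[OF assms(8) _ that] assms(2) by (simp_all add: h_def)
  have lower: "2 powr s * f ((a + b) / 2) / \<alpha> \<le> J"
  proof (rule has_integral_le[OF _ J])
    show "((\<lambda>u. u powr (\<alpha> - 1) * (2 powr s * f ((a + b) / 2))) has_integral
        2 powr s * f ((a + b) / 2) / \<alpha>) {0..1}"
      using has_integral_mult_left[OF has_integral_powr_unit[OF assms(5)]] by simp
  qed (use bounds in \<open>auto intro!: mult_left_mono\<close>)
  have "((\<lambda>u. u powr (\<alpha> + s - 1) + u powr (\<alpha> - 1) * (1 - u) powr (s + 1 - 1)) has_integral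
      1 / (\<alpha> + s) + Beta \<alpha> (s + 1)) {0..1}"
    using assms(5,6) by (intro has_integral_add has_integral_powr_unit has_integral_Beta_real) auto
  from has_integral_mult_left[OF this, of "f a + f b"]
  have U: "((\<lambda>u. u powr (\<alpha> - 1) * ((u powr s + (1 - u) powr s) * (f a + f b))) has_integral
      (1 / (\<alpha> + s) + Beta \<alpha> (s + 1)) * (f a + f b)) {0..1}"
    by (simp add: algebra_simps powr_add[symmetric])
  have upper: "J \<le> (1 / (\<alpha> + s) + Beta \<alpha> (s + 1)) * (f a + f b)"
    by (rule has_integral_le[OF J U]) (use bounds in \<open>auto intro!: mult_left_mono\<close>)
  have G: "Gamma (\<alpha> + 1) = \<alpha> * Gamma \<alpha>"
    using assms(5) by (intro Gamma_plus1) (auto elim!: nonpos_Ints_cases)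
  have M: "Gamma (\<alpha> + 1) / (b - a) powr \<alpha> * ((RL_left a \<alpha> f b + RL_right b \<alpha> f a) / 2)
      = \<alpha> / 2 * J"
    by (simp add: G J_def)
  have "2 powr (s - 1) * f ((a + b) / 2) = \<alpha> / 2 * (2 powr s * f ((a + b) / 2) / \<alpha>)"
    using assms(5) by (simp add: powr_diff)
  also have "\<dots> \<le> \<alpha> / 2 * J"
    using lower assms(5) by (intro mult_left_mono) auto
  finally have 1: "2 powr (s - 1) * f ((a + b) / 2) \<le> \<alpha> / 2 * J" .
  have "\<alpha> / 2 * J \<le> \<alpha> / 2 * ((1 / (\<alpha> + s) + Beta \<alpha> (s + 1)) * (f a + f b))"
    using upper assms(5) by (intro mult_left_mono) auto
  with 1 show ?thesis unfolding M by simp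
qed

end
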